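(* Let $d\geq 1$ be an integer. For every integer $n\geq \left\lceil\frac{24}{\pi^2}\left(\ln\left(\frac{7d}{2}\right)\right)^2+\frac{1}{24}\right\rceil$, \[(-1)^n\big(M_0(n)-M_1(n)\big)> d.\]
   Context: For a partition $\lambda$ of a positive integer, let $\omega(\lambda)$ be the number of parts equal to $1$ and let $\nu(\lambda)$ be the number of parts of $\lambda$ strictly larger than $\omega(\lambda)$. The crank of $\lambda$ is its largest part if $\omega(\lambda)=0$, and $\nu(\lambda)-\omega(\lambda)$ if $\omega(\lambda)>0$. For $n\geq 0$, $M_0(n)$ (resp. $M_1(n)$) denotes the number of partitions of $n$ with even (resp. odd) crank. *)

theory Defs
  imports "HOL-Analysis.Analysis" "HOL-Library.Multiset"
begin

definition partitions :: "nat \<Rightarrow> nat multiset set" where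
  "partitions n = {l. 0 \<notin># l \<and> \<Sum>\<^sub># l = n}"

definition ones :: "nat multiset \<Rightarrow> nat" where
  "ones l = count l 1"

definition parts_above_ones :: "nat multiset \<Rightarrow> nat" where
  "parts_above_ones l = size (filter_mset (\<lambda>k. k > ones l) l)"

(* The empty partition (of 0) has no largest part; inserting 0 gives it crank 0 and does not
   change the maximum of any nonempty partition. *)
definition crank :: "nat multiset \<Rightarrow> int" where
  "crank l = (if ones l = 0 then int (Max (insert 0 (set_mset l)))
              else int (parts_above_ones l) - int (ones l))"

definition M0 :: "nat \<Rightarrow> nat" where
  "M0 n = card {l \<in> partitions n. even (crank l)}"

definition M1 :: "nat \<Rightarrow> nat" where
  "M1 n = card {l \<in> partitions n. odd (crank l)}"

(* Finiteness ensures that the cardinalities above are genuine counts. *)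
lemma finite_partitions: "finite (partitions n)"
proof -
  have "partitions n \<subseteq> mset ` {xs. set xs \<subseteq> {..n} \<and> length xs \<le> n}"
  proof
    fix l assume "l \<in> partitions n"
    then have l: "0 \<notin># l" "sum_mset l = n" by (auto simp: partitions_def)
    obtain xs where xs: "l = mset xs" by (metis ex_mset)
    have le: "x \<le> n" if "x \<in># l" for x
      using that l(2) by (metis le_add1 multi_member_split sum_mset.add_mset)
    have "size k \<le> sum_mset k" if "0 \<notin># k" for k :: "nat multiset"
      using that by (induction k) auto
    then have "length xs \<le> n" using l xs by (metis size_mset)
    then show "l \<in> mset ` {xs. set xs \<subseteq> {..n} \<and> length xs \<le> n}"
      using le xs by auto
  qed
  then show ?thesis
    by (rule finite_subset) (intro finite_imageI finite_lists_length_le finite_atMost)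
qed

end

theory Submission
  imports Defs "HOL-Computational_Algebra.Formal_Power_Series" "HOL-Library.Discrete_Functions"
begin

text \<open>
  Sorting partitions by their number of ones and summing with the \<open>q\<close>-binomial theorem, the generating
  function of \<open>M\<^sub>0(n) - M\<^sub>1(n)\<close> agrees, from \<open>q\<^sup>2\<close> on, with \<open>(q; q) / (-q; q)\<^sup>2\<close>. By Gauss,
  \<open>(q; q) / (-q; q) = \<Sum>\<^sub>s (-1)\<^sup>s q\<^bsup>s\<^sup>2\<^esup>\<close>, and by Euler \<open>1 / (-q; q) = (q; q\<^sup>2)\<close>. Substituting \<open>-q\<close> for \<open>q\<close>
  makes both factors nonnegative: \<open>(-1)\<^sup>n (M\<^sub>0(n) - M\<^sub>1(n))\<close> is the sum over all integers \<open>s\<close> of the number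
  of partitions of \<open>n - s\<^sup>2\<close> into distinct odd parts. With \<open>r = \<lfloor>\<surd>n\<rfloor>\<close>, each of the terms \<open>s = 0, 1, -1\<close>
  is at least \<open>2\<^bsup>r - 2\<^esup>\<close>, which suffices since \<open>exp (pi / \<surd>24) < 2\<close>.

  Infinite products are replaced by finite ones, compared modulo \<open>q\<^bsup>N + 1\<^esup>\<close>.
\<close>

section \<open>Formal power series up to a given degree\<close>

text \<open>Divisibility rather than coefficientwise equality: compatibility with sums and products
  then comes from the rules for \<open>dvd\<close>.\<close>

definition fps_eq_upto :: "nat \<Rightarrow> 'a::field fps \<Rightarrow> 'a fps \<Rightarrow> bool" where
  "fps_eq_upto N f g \<longleftrightarrow> fps_X ^ Suc N dvd f - g"

lemma fps_eq_upto_refl [simp]: "fps_eq_upto N f f"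
  by (simp add: fps_eq_upto_def)

lemma fps_eq_upto_sym: "fps_eq_upto N f g \<Longrightarrow> fps_eq_upto N g f"
  unfolding fps_eq_upto_def by (subst dvd_minus_iff[symmetric]) simp

lemma fps_eq_upto_trans [trans]:
  "fps_eq_upto N f g \<Longrightarrow> fps_eq_upto N g h \<Longrightarrow> fps_eq_upto N f h"
  unfolding fps_eq_upto_def using dvd_add[of _ "f - g" "g - h"] by simp

lemma fps_eq_upto_add:
  "fps_eq_upto N f g \<Longrightarrow> fps_eq_upto N f' g' \<Longrightarrow> fps_eq_upto N (f + f') (g + g')"
  unfolding fps_eq_upto_def add_diff_add by (rule dvd_add)

lemma fps_eq_upto_mult:
  assumes "fps_eq_upto N f g" "fps_eq_upto N f' g'"
  shows "fps_eq_upto N (f * f') (g * g')"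
proof -
  have "f * f' - g * g' = (f - g) * f' + g * (f' - g')"
    by (simp add: algebra_simps)
  then show ?thesis
    using assms unfolding fps_eq_upto_def by simp
qed

lemma fps_eq_upto_prod:
  "(\<And>i. i \<in> I \<Longrightarrow> fps_eq_upto N (f i) (g i)) \<Longrightarrow> fps_eq_upto N (prod f I) (prod g I)"
  by (induction I rule: infinite_finite_induct) (auto intro: fps_eq_upto_mult)

lemma fps_eq_upto_sum:
  "(\<And>i. i \<in> I \<Longrightarrow> fps_eq_upto N (f i) (g i)) \<Longrightarrow> fps_eq_upto N (sum f I) (sum g I)"
  by (induction I rule: infinite_finite_induct) (auto intro: fps_eq_upto_add)

lemma fps_eq_upto_nth:
  assumes "fps_eq_upto N f g" "i \<le> N"
  shows "fps_nth f i = fps_nth g i"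
proof -
  obtain h where "f - g = fps_X ^ Suc N * h"
    using assms unfolding fps_eq_upto_def by (elim dvdE)
  then have "fps_nth (f - g) i = 0"
    using assms(2) by (simp only: fps_X_power_mult_nth) simp
  then show ?thesis by simp
qed

lemma fps_eq_upto_X_power: "N < k \<Longrightarrow> fps_eq_upto N (fps_X ^ k * f) 0"
  by (simp add: fps_eq_upto_def le_imp_power_dvd dvd_mult2 del: power_Suc)

lemma fps_one_minus_X_power_inverse [simp]:
  fixes k :: nat assumes "k > 0"
  shows "inverse (1 - fps_X ^ k :: 'a::field fps) * (1 - fps_X ^ k) = 1"
  using assms by (intro inverse_mult_eq_1) simp

lemma fps_one_plus_X_power_inverse [simp]:
  fixes k :: nat assumes "k > 0"
  shows "inverse (1 + fps_X ^ k :: 'a::field fps) * (1 + fps_X ^ k) = 1"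
  using assms by (intro inverse_mult_eq_1) simp

section \<open>The truncated $q$-binomial theorem\<close>

text \<open>In standard notation \<open>(a; q)_m / (q; q)_m\<close> with \<open>q = fps_X\<close>.
  The crank leads to the cases \<open>a = 0\<close> and \<open>a = -q\<close>.\<close>

definition qbinom_coeff :: "'a::field fps \<Rightarrow> nat \<Rightarrow> 'a fps" where
  "qbinom_coeff a m = (\<Prod>i<m. (1 - a * fps_X ^ i) * inverse (1 - fps_X ^ Suc i))"

definition qbinom_sum :: "'a::field fps \<Rightarrow> nat \<Rightarrow> 'a fps \<Rightarrow> 'a fps" where
  "qbinom_sum a W x = (\<Sum>m\<le>W. qbinom_coeff a m * x ^ m)"

lemma qbinom_coeff_0 [simp]: "qbinom_coeff a 0 = 1"
  by (simp add: qbinom_coeff_def)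

lemma qbinom_coeff_Suc:
  "qbinom_coeff a (Suc m) * (1 - fps_X ^ Suc m) = qbinom_coeff a m * (1 - a * fps_X ^ m)"
  using fps_one_minus_X_power_inverse[of "Suc m"]
  by (simp add: qbinom_coeff_def mult.assoc del: power_Suc)

text \<open>The full series satisfies \<open>(1 - x) F(x) = (1 - a x) F(q x)\<close>; cutting it off
  at \<open>W\<close> leaves one boundary term.\<close>

lemma qbinom_sum_functional_equation:
  "(1 - x) * qbinom_sum a W x - (1 - a * x) * qbinom_sum a W (fps_X * x)
     = - (x ^ Suc W * (qbinom_coeff a (Suc W) * (1 - fps_X ^ Suc W)))"
proof (induction W)
  case 0
  then show ?case
    by (simp add: qbinom_coeff_Suc[of a 0, simplified] qbinom_sum_def) (simp add: algebra_simps)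
next
  case (Suc W)
  have "(1 - x) * qbinom_sum a (Suc W) x - (1 - a * x) * qbinom_sum a (Suc W) (fps_X * x)
     = ((1 - x) * qbinom_sum a W x - (1 - a * x) * qbinom_sum a W (fps_X * x))
       + qbinom_coeff a (Suc W) * x ^ Suc W * ((1 - x) - (1 - a * x) * fps_X ^ Suc W)"
    by (simp add: qbinom_sum_def algebra_simps power_mult_distrib)
  also have "\<dots> = - (x ^ Suc (Suc W) * (qbinom_coeff a (Suc W) * (1 - a * fps_X ^ Suc W)))"
    unfolding Suc.IH by (simp add: algebra_simps)
  finally show ?case by (simp only: qbinom_coeff_Suc)
qed

text \<open>At \<open>x = - (q ^ k)\<close> with \<open>k > 0\<close> the boundary term contains
  \<open>x ^ Suc W\<close>, so it vanishes up to degree \<open>W\<close>.\<close>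

lemma qbinom_sum_step:
  assumes "k > 0"
  shows "fps_eq_upto W ((1 + fps_X ^ k) * qbinom_sum a W (- (fps_X ^ k)))
           ((1 + a * fps_X ^ k) * qbinom_sum a W (- (fps_X ^ Suc k)))"
proof -
  have "fps_X dvd - (fps_X ^ k :: 'a fps)"
    using assms by (simp add: dvd_power)
  then have "fps_X ^ Suc W dvd (- (fps_X ^ k :: 'a fps)) ^ Suc W"
    by (rule dvd_power_same)
  moreover have "(1 + fps_X ^ k) * qbinom_sum a W (- (fps_X ^ k))
      - (1 + a * fps_X ^ k) * qbinom_sum a W (- (fps_X ^ Suc k))
      = - ((- (fps_X ^ k)) ^ Suc W * (qbinom_coeff a (Suc W) * (1 - fps_X ^ Suc W)))"
    using qbinom_sum_functional_equation[of "- (fps_X ^ k)" a W] by simp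
  ultimately show ?thesis
    unfolding fps_eq_upto_def by (simp only: dvd_minus_iff dvd_mult2)
qed

lemma qbinom_sum_far: "fps_eq_upto W (qbinom_sum a W (- (fps_X ^ Suc W))) 1"
proof -
  have "fps_eq_upto W (\<Sum>m\<le>W. qbinom_coeff a m * (- (fps_X ^ Suc W)) ^ m)
          (\<Sum>m\<le>W. if m = 0 then 1 else 0)"
  proof (rule fps_eq_upto_sum)
    fix m assume "m \<in> {..W}"
    show "fps_eq_upto W (qbinom_coeff a m * (- (fps_X ^ Suc W)) ^ m) (if m = 0 then 1 else 0)"
    proof (cases m)
      case (Suc m')
      then have "fps_X ^ Suc W dvd (- (fps_X ^ Suc W :: 'a fps)) ^ m"
        by (simp only: power_Suc[of _ m']) (intro dvd_mult2, simp only: dvd_minus_iff dvd_refl)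
      then show ?thesis using Suc by (simp add: fps_eq_upto_def dvd_mult del: power_Suc)
    qed simp
  qed
  then show ?thesis by (simp add: qbinom_sum_def)
qed

text \<open>Using \<open>qbinom_sum_step\<close> for \<open>k = 1, ..., N\<close> moves the argument
  from \<open>-q\<close> to \<open>- (q ^ (N + 1))\<close>, where only the term \<open>m = 0\<close>
  survives.\<close>

lemma qbinom_theorem_upto:
  "fps_eq_upto N ((\<Prod>k=1..N. 1 + fps_X ^ k) * qbinom_sum a N (- fps_X))
     (\<Prod>k=1..N. 1 + a * fps_X ^ k)"
proof -
  have "fps_eq_upto N ((\<Prod>k=1..K. 1 + fps_X ^ k) * qbinom_sum a N (- fps_X))
     ((\<Prod>k=1..K. 1 + a * fps_X ^ k) * qbinom_sum a N (- (fps_X ^ Suc K)))" for K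
  proof (induction K)
    case (Suc K)
    have "fps_eq_upto N ((1 + fps_X ^ Suc K) * ((\<Prod>k=1..K. 1 + fps_X ^ k) * qbinom_sum a N (- fps_X)))
       ((1 + fps_X ^ Suc K) * ((\<Prod>k=1..K. 1 + a * fps_X ^ k) * qbinom_sum a N (- (fps_X ^ Suc K))))"
      by (intro fps_eq_upto_mult Suc.IH) simp
    also have "\<dots> = (\<Prod>k=1..K. 1 + a * fps_X ^ k) * ((1 + fps_X ^ Suc K) * qbinom_sum a N (- (fps_X ^ Suc K)))"
      by (rule mult.left_commute)
    also have "fps_eq_upto N \<dots>
       ((\<Prod>k=1..K. 1 + a * fps_X ^ k) * ((1 + a * fps_X ^ Suc K) * qbinom_sum a N (- (fps_X ^ Suc (Suc K)))))"
      by (intro fps_eq_upto_mult fps_eq_upto_refl qbinom_sum_step) simp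
    finally show ?case by (simp add: mult_ac del: power_Suc)
  qed simp
  note this[of N]
  also have "fps_eq_upto N ((\<Prod>k=1..N. 1 + a * fps_X ^ k) * qbinom_sum a N (- (fps_X ^ Suc N)))
      ((\<Prod>k=1..N. 1 + a * fps_X ^ k) * 1)"
    by (intro fps_eq_upto_mult fps_eq_upto_refl qbinom_sum_far)
  finally show ?thesis by simp
qed

section \<open>Theta series and the products of Gauss and Euler\<close>

definition theta_ratio :: "nat \<Rightarrow> nat \<Rightarrow> 'a::field fps" where
  "theta_ratio s n = (\<Prod>k\<in>{s<..n}. (1 - fps_X ^ k) * inverse (1 + fps_X ^ k))"

text \<open>The case \<open>s = 0\<close> is separate because the general formula would contain
  \<open>2 * inverse 2\<close>, which is 0 in characteristic 2.\<close>

definition shanks_term :: "nat \<Rightarrow> nat \<Rightarrow> 'a::field fps" where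
  "shanks_term n s = (if s = 0 then theta_ratio 0 n
     else 2 * inverse (1 + fps_X ^ s) * (-1) ^ s * fps_X ^ (s * Suc n) * theta_ratio s n)"

lemma theta_ratio_self [simp]: "theta_ratio n n = 1"
  by (simp add: theta_ratio_def)

lemma mult_inverse_cancel:
  fixes v :: "'a::comm_ring_1"
  assumes "v * w = 1"
  shows "w * (u * v * r) = u * r"
proof -
  have "w * (u * v * r) = (v * w) * (u * r)" by (simp add: mult_ac)
  then show ?thesis using assms by simp
qed

lemma theta_ratio_Suc_right:
  assumes "s \<le> n"
  shows "(1 + fps_X ^ Suc n) * theta_ratio s (Suc n) = (1 - fps_X ^ Suc n) * (theta_ratio s n :: 'a::field fps)"
proof -
  have "{s<..Suc n} = insert (Suc n) {s<..n}" using assms by auto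
  then have "(theta_ratio s (Suc n) :: 'a fps) = (1 - fps_X ^ Suc n) * inverse (1 + fps_X ^ Suc n) *
      theta_ratio s n"
    by (simp add: theta_ratio_def del: power_Suc)
  then show ?thesis
    by (simp only: mult_inverse_cancel[OF fps_one_plus_X_power_inverse[OF zero_less_Suc[of n]]])
qed

lemma theta_ratio_Suc_left:
  assumes "s < n"
  shows "(1 - fps_X ^ Suc s) * theta_ratio (Suc s) n = (1 + fps_X ^ Suc s) * (theta_ratio s n :: 'a::field fps)"
proof -
  have "{s<..n} = insert (Suc s) {Suc s<..n}" using assms by auto
  then have "(theta_ratio s n :: 'a fps) = (1 - fps_X ^ Suc s) * inverse (1 + fps_X ^ Suc s) *
      theta_ratio (Suc s) n"
    by (simp add: theta_ratio_def del: power_Suc)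
  then show ?thesis
    by (simp only: mult_inverse_cancel[OF fps_one_plus_X_power_inverse[OF zero_less_Suc[of s]]])
qed

text \<open>A finite form, due to Shanks, of the theta product identity of Gauss. The difference of the left-hand
  sides for \<open>n + 1\<close> and \<open>n\<close> telescopes after multiplication by \<open>1 + q\<^bsup>n + 1\<^esup>\<close>.\<close>

lemma shanks_identity:
  "(\<Sum>s\<le>n. shanks_term n s) = 1 + 2 * (\<Sum>s=1..n. (-1) ^ s * fps_X ^ (s\<^sup>2) :: 'a::field fps)"
proof (induction n)
  case (Suc n)
  define U :: "'a fps" where "U = fps_X ^ Suc n"
  \<comment> \<open>The partial sums have a closed form, so the induction on \<open>m\<close> needs
    only the two recursions of \<open>theta_ratio\<close>.\<close>
  have telescope: "(\<Sum>s\<le>m. (1 + U) * shanks_term (Suc n) s - (1 + U) * shanks_term n s)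
      = - 2 * (-1) ^ m * U ^ Suc m * theta_ratio m n" if "m \<le> n" for m
    using that
  proof (induction m)
    case 0
    have "(1 + U) * theta_ratio 0 (Suc n) = (1 - U) * theta_ratio 0 n"
      unfolding U_def by (rule theta_ratio_Suc_right) simp
    then show ?case by (simp add: shanks_term_def algebra_simps)
  next
    case (Suc m)
    define V :: "'a fps" where "V = fps_X ^ Suc m"
    define c :: "'a fps" where "c = 2 * inverse (1 + V) * (-1) ^ Suc m * U ^ Suc m"
    have inv: "inverse (1 + V) * (1 + V) = 1"
      unfolding V_def by (rule fps_one_plus_X_power_inverse) simp
    have UV1: "fps_X ^ (Suc m * Suc n) = U ^ Suc m"
      by (subst mult.commute) (simp only: U_def power_mult)
    have UV2: "fps_X ^ (Suc m * Suc (Suc n)) = V * U ^ Suc m"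
      by (subst mult_Suc_right) (simp only: power_add V_def UV1)
    have s0: "shanks_term n (Suc m) = c * theta_ratio (Suc m) n"
      and s1: "shanks_term (Suc n) (Suc m) = c * V * theta_ratio (Suc m) (Suc n)"
      unfolding shanks_term_def UV1 UV2 c_def by (simp_all add: V_def mult_ac)
    have r: "(1 + U) * theta_ratio (Suc m) (Suc n) = (1 - U) * theta_ratio (Suc m) n"
      unfolding U_def using Suc.prems by (intro theta_ratio_Suc_right) simp
    have l: "(1 - V) * theta_ratio (Suc m) n = (1 + V) * theta_ratio m n"
      unfolding V_def using Suc.prems by (intro theta_ratio_Suc_left) simp
    have "(1 + U) * shanks_term (Suc n) (Suc m) - (1 + U) * shanks_term n (Suc m)
      = c * V * ((1 + U) * theta_ratio (Suc m) (Suc n)) - c * (1 + U) * theta_ratio (Suc m) n"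
      by (simp add: s0 s1 algebra_simps)
    \<comment> \<open>Writing \<open>V * (1 - U) - (1 + U)\<close> as
      \<open>- (1 - V) - U * (1 + V)\<close> lets \<open>l\<close> produce a common factor
      \<open>1 + V\<close>, which cancels the inverse in \<open>c\<close>.\<close>
    also have "\<dots> = - c * ((1 - V) * theta_ratio (Suc m) n) - c * U * (1 + V) * theta_ratio (Suc m) n"
      unfolding r by (simp add: algebra_simps)
    also have "\<dots> = - (c * (1 + V)) * (theta_ratio m n + U * theta_ratio (Suc m) n)"
      unfolding l by (simp add: algebra_simps)
    also have "c * (1 + V) = 2 * (-1) ^ Suc m * U ^ Suc m"
      using inv by (simp add: c_def mult_ac)
    finally show ?case
      using Suc.IH Suc.prems by (simp add: algebra_simps)
  qed
  have inv: "inverse (1 + U) * (1 + U) = 1"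
    unfolding U_def by (rule fps_one_plus_X_power_inverse) simp
  \<comment> \<open>The term \<open>s = n + 1\<close> has no counterpart in the sum for
    \<open>n\<close>; added to the telescoped part, it makes \<open>1 + U\<close> a factor that can
    be cancelled.\<close>
  have last: "(1 + U) * shanks_term (Suc n) (Suc n) = 2 * (-1) ^ Suc n * U ^ Suc (Suc n)"
  proof -
    have "fps_X ^ (Suc n * Suc (Suc n)) = U ^ Suc (Suc n)"
      by (simp only: U_def power_mult)
    then have "shanks_term (Suc n) (Suc n) = 2 * inverse (1 + U) * (-1) ^ Suc n * U ^ Suc (Suc n)"
      unfolding shanks_term_def U_def by simp
    then show ?thesis using inv by (simp add: mult_ac)
  qed
  have "(1 + U) * (\<Sum>s\<le>Suc n. shanks_term (Suc n) s)
      = (1 + U) * (\<Sum>s\<le>n. shanks_term n s) - 2 * (-1) ^ n * U ^ Suc n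
        + 2 * (-1) ^ Suc n * U ^ Suc (Suc n)"
    using telescope[of n] last
    by (simp add: sum_subtractf distrib_left flip: sum_distrib_left) (simp add: algebra_simps)
  also have "\<dots> = (1 + U) * ((\<Sum>s\<le>n. shanks_term n s) + 2 * ((-1) ^ Suc n * U ^ Suc n))"
    by (simp add: algebra_simps)
  finally have "(\<Sum>s\<le>Suc n. shanks_term (Suc n) s)
      = (\<Sum>s\<le>n. shanks_term n s) + 2 * ((-1) ^ Suc n * U ^ Suc n)"
    using inv by (metis mult_cancel_left mult_zero_right one_neq_zero)
  moreover have "U ^ Suc n = fps_X ^ ((Suc n)\<^sup>2)"
    by (simp only: U_def power2_eq_square power_mult)
  moreover have "(\<Sum>s=1..Suc n. (-1) ^ s * fps_X ^ (s\<^sup>2) :: 'a fps)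
      = (\<Sum>s=1..n. (-1) ^ s * fps_X ^ (s\<^sup>2)) + (-1) ^ Suc n * fps_X ^ ((Suc n)\<^sup>2)"
    by simp
  ultimately show ?case
    by (simp only: Suc.IH distrib_left add.assoc)
qed (simp add: shanks_term_def)

text \<open>In \<open>shanks_identity\<close> each term with \<open>s > 0\<close> carries the factor
  \<open>q ^ (s * (N + 1))\<close>, so only \<open>s = 0\<close> survives.\<close>

lemma theta_product_upto:
  "fps_eq_upto N (theta_ratio 0 N) (1 + 2 * (\<Sum>s=1..N. (-1) ^ s * fps_X ^ (s\<^sup>2)))"
proof -
  have "fps_eq_upto N (\<Sum>s\<le>N. if s = 0 then theta_ratio 0 N else 0) (\<Sum>s\<le>N. shanks_term N s)"
  proof (rule fps_eq_upto_sum)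
    fix s
    show "fps_eq_upto N (if s = 0 then theta_ratio 0 N else 0) (shanks_term N s)"
    proof (cases s)
      case (Suc s')
      then have "s > 0" "N < s * Suc N" by simp_all
      moreover have "shanks_term N s
          = fps_X ^ (s * Suc N) * (2 * inverse (1 + fps_X ^ s) * (-1) ^ s * theta_ratio s N)"
        using \<open>s > 0\<close> by (simp only: shanks_term_def mult_ac if_False less_irrefl neq0_conv split: if_split) simp
      ultimately have "fps_eq_upto N (shanks_term N s) 0"
        using fps_eq_upto_X_power by metis
      then show ?thesis using \<open>s > 0\<close> by (auto intro: fps_eq_upto_sym)
    qed (simp add: shanks_term_def)
  qed
  then show ?thesis by (simp add: shanks_identity)
qed

text \<open>The pairs \<open>(1 - q ^ k) * (1 + q ^ k) = 1 - q ^ (2 * k)\<close> supply the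
  even-indexed factors on the right, the third product the odd ones.\<close>

lemma euler_odd_distinct_exact:
  "(\<Prod>k=1..N. 1 - fps_X ^ k) * ((\<Prod>k=1..N. 1 + fps_X ^ k) * (\<Prod>k=1..N. 1 - fps_X ^ (2 * k - 1)))
     = (\<Prod>k=1..2 * N. 1 - fps_X ^ k :: 'a::field fps)"
proof (induction N)
  case (Suc N)
  have sq: "(1 - fps_X ^ Suc N) * (1 + fps_X ^ Suc N) = (1 - fps_X ^ Suc (Suc (2 * N)) :: 'a fps)"
    by (simp add: algebra_simps flip: power_add power_Suc)
  have odd_part: "(\<Prod>k=1..Suc N. 1 - fps_X ^ (2 * k - 1) :: 'a fps)
      = (\<Prod>k=1..N. 1 - fps_X ^ (2 * k - 1)) * (1 - fps_X ^ Suc (2 * N))"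
    by simp
  have all_parts: "(\<Prod>k=1..2 * Suc N. 1 - fps_X ^ k :: 'a fps)
      = (\<Prod>k=1..2 * N. 1 - fps_X ^ k) * (1 - fps_X ^ Suc (2 * N)) * (1 - fps_X ^ Suc (Suc (2 * N)))"
    by simp
  have "(\<Prod>k=1..Suc N. f k) = (\<Prod>k=1..N. f k) * f (Suc N)" for f :: "nat \<Rightarrow> 'a fps"
    by simp
  then show ?case
    unfolding odd_part all_parts Suc.IH[symmetric] sq[symmetric] by (simp only: mult_ac)
qed simp

text \<open>Cancelling \<open>(q; q)_N\<close> in the exact identity leaves the factors with
  \<open>N < k <= 2 * N\<close>, each equal to 1 up to degree \<open>N\<close>.\<close>

lemma euler_odd_distinct_upto:
  "fps_eq_upto N ((\<Prod>k=1..N. 1 + fps_X ^ k) * (\<Prod>k=1..N. 1 - fps_X ^ (2 * k - 1))) (1 :: 'a::field fps)"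
proof -
  have nz: "(\<Prod>k=1..N. 1 - fps_X ^ k) \<noteq> (0 :: 'a fps)"
  proof -
    have "(1 - fps_X ^ k) \<noteq> (0 :: 'a fps)" if "k \<in> {1..N}" for k
      using fps_one_minus_X_power_inverse[of k, where ?'a = 'a] that
      by (metis atLeastAtMost_iff less_le_trans less_numeral_extra(1) mult_zero_right zero_neq_one)
    then show ?thesis by simp
  qed
  have "(\<Prod>k=1..2 * N. 1 - fps_X ^ k :: 'a fps)
      = (\<Prod>k=1..N. 1 - fps_X ^ k) * (\<Prod>k\<in>{N<..2 * N}. 1 - fps_X ^ k)"
  proof -
    have "{1..2 * N} = {1..N} \<union> {N<..2 * N}" by auto
    then show ?thesis
      by (simp only:) (rule prod.union_disjoint, auto)
  qed
  then have "(\<Prod>k=1..N. 1 + fps_X ^ k) * (\<Prod>k=1..N. 1 - fps_X ^ (2 * k - 1))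
      = (\<Prod>k\<in>{N<..2 * N}. 1 - fps_X ^ k :: 'a fps)"
    using euler_odd_distinct_exact[of N, where ?'a = 'a] nz by simp
  also have "fps_eq_upto N \<dots> (\<Prod>k\<in>{N<..2 * N}. 1)"
    by (rule fps_eq_upto_prod) (simp add: fps_eq_upto_def le_imp_power_dvd del: power_Suc)
  finally show ?thesis by simp
qed

section \<open>Partitions into distinct odd parts\<close>

definition odd_sum :: "nat set \<Rightarrow> nat" where
  "odd_sum K = (\<Sum>k\<in>K. 2 * k - 1)"

text \<open>An index \<open>k\<close> stands for the part \<open>2 * k - 1\<close>. If
  \<open>m <= N\<close>, the bound \<open>N\<close> excludes no partition of \<open>m\<close> into
  distinct odd parts.\<close>

definition odd_distinct :: "nat \<Rightarrow> nat \<Rightarrow> nat set set" where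
  "odd_distinct N m = {K. K \<subseteq> {1..N} \<and> odd_sum K = m}"

lemma odd_sum_insert: "finite K \<Longrightarrow> k \<notin> K \<Longrightarrow> odd_sum (insert k K) = 2 * k - 1 + odd_sum K"
  by (simp add: odd_sum_def)

lemma odd_sum_parity:
  assumes "finite K" "0 \<notin> K"
  shows "(-1) ^ odd_sum K = ((-1) ^ card K :: 'a::comm_ring_1)"
  using assms
proof (induction K rule: finite_induct)
  case (insert k K)
  then have "(-1) ^ (2 * k - 1) = (-1 :: 'a)" by simp
  with insert show ?case by (simp add: odd_sum_insert power_add del: Nat.add_diff_assoc2)
qed (simp add: odd_sum_def)

lemma odd_sum_initial: "odd_sum {1..r} = r\<^sup>2"
  by (induction r) (simp_all add: odd_sum_def power2_eq_square)

text \<open>Expanding over subsets gives the signs \<open>(-1) ^ card K\<close>. As all parts are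
  odd, the sign depends only on \<open>m\<close>.\<close>

lemma fps_nth_odd_product:
  "fps_nth (\<Prod>k=1..N. 1 - fps_X ^ (2 * k - 1) :: 'a::comm_ring_1 fps) m
     = (-1) ^ m * of_nat (card (odd_distinct N m))"
proof -
  have "(\<Prod>k=1..N. 1 - fps_X ^ (2 * k - 1) :: 'a fps)
      = (\<Sum>K\<in>Pow {1..N}. (-1) ^ card K * fps_X ^ odd_sum K)"
    by (subst prod_diff_conv_sum) (simp_all add: odd_sum_def power_sum)
  also have "fps_nth \<dots> m = (\<Sum>K\<in>Pow {1..N}. (-1) ^ card K * (if odd_sum K = m then 1 else 0))"
  proof -
    have "fps_nth ((-1) ^ c * f) m = (-1) ^ c * fps_nth f m" for c and f :: "'a fps"
      by (cases "even c") simp_all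
    then show ?thesis by (auto simp: fps_sum_nth intro!: sum.cong)
  qed
  also have "\<dots> = (\<Sum>K\<in>Pow {1..N}. if odd_sum K = m then (-1) ^ m else 0)"
  proof (rule sum.cong)
    fix K assume "K \<in> Pow {1..N}"
    then have "finite K" "0 \<notin> K" by (auto intro: finite_subset)
    then show "(-1) ^ card K * (if odd_sum K = m then 1 else 0) = (if odd_sum K = m then (-1) ^ m else 0 :: 'a)"
      using odd_sum_parity[of K, where ?'a = 'a] by auto
  qed simp
  also have "\<dots> = (\<Sum>K\<in>odd_distinct N m. (-1) ^ m)"
    by (rule sum.mono_neutral_cong_right) (auto simp: odd_distinct_def)
  finally show ?thesis by simp
qed

text \<open>A subset of the parts \<open>3, 5, \<dots>, 2 r - 3\<close> has sum at most \<open>(r - 1)\<^sup>2 - 1\<close>. Once the part \<open>1\<close> has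
  been used to correct the parity, the remainder is a single larger odd part.\<close>

lemma card_odd_distinct_ge:
  assumes "2 \<le> r" "r\<^sup>2 \<le> m + 1" "m \<le> N"
  shows "2 ^ (r - 2) \<le> card (odd_distinct N m)"
proof -
  \<comment> \<open>The part 1 is added exactly when the remainder would be even; \<open>j T\<close>
    is then the index of the part equal to the odd remainder.\<close>
  define U where "U T = (if odd (m - odd_sum T) then T else insert 1 T)" for T
  define j where "j T = (m - odd_sum (U T) + 1) div 2" for T
  define f where "f T = insert (j T) (U T)" for T
  have U: "odd_sum (U T) \<le> (r - 1)\<^sup>2 \<and> odd (m - odd_sum (U T)) \<and> odd_sum (U T) < m"
    if T: "T \<subseteq> {2..r - 1}" for T
  proof -
    have fin: "finite T" and "1 \<notin> T" using T by (auto intro: finite_subset)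
    have "insert 1 T \<subseteq> {1..r - 1}" using T assms(1) by auto
    then have "odd_sum (insert 1 T) \<le> odd_sum {1..r - 1}"
      unfolding odd_sum_def by (intro sum_mono2) auto
    then have "odd_sum T + 1 \<le> (r - 1)\<^sup>2"
      using fin \<open>1 \<notin> T\<close> unfolding odd_sum_initial by (simp add: odd_sum_insert)
    moreover have "(r - 1)\<^sup>2 < m"
    proof -
      obtain q where "r = Suc (Suc q)" using assms(1) by (metis add_2_eq_Suc le_Suc_ex)
      then show ?thesis using assms(2) by (simp add: power2_eq_square)
    qed
    ultimately show ?thesis
      using fin \<open>1 \<notin> T\<close> by (auto simp: U_def odd_sum_insert)
  qed
  have j: "2 * j T - 1 = m - odd_sum (U T) \<and> r \<le> j T \<and> j T \<le> N" if T: "T \<subseteq> {2..r - 1}" for T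
  proof -
    obtain q where q: "r = Suc (Suc q)" using assms(1) by (metis add_2_eq_Suc le_Suc_ex)
    obtain i where i: "m - odd_sum (U T) = 2 * i + 1"
      using U[OF T] by (elim conjE oddE)
    then have "j T = Suc i" by (simp add: j_def)
    \<comment> \<open>By parity this gives \<open>r <= i + 1\<close>, so the new index exceeds all
      those in \<open>U T\<close>.\<close>
    moreover have "2 * r - 2 \<le> 2 * i + 1"
    proof -
      have "odd_sum (U T) \<le> q * q + 2 * q + 1" "q * q + 4 * q + 3 \<le> m"
        using U[OF T] assms(2) q by (simp_all add: power2_eq_square)
      then show ?thesis using q unfolding i[symmetric] by linarith
    qed
    ultimately show ?thesis using i assms(3) by auto
  qed
  have f: "f T \<in> odd_distinct N m \<and> f T \<inter> {2..r - 1} = T" if T: "T \<subseteq> {2..r - 1}" for T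
  proof -
    have sub: "U T \<subseteq> {1..r - 1}" using T assms(1) by (auto simp: U_def)
    then have "finite (U T)" "j T \<notin> U T" using j[OF T] assms(1) by (auto intro: finite_subset)
    then have "odd_sum (f T) = m"
      using j[OF T] U[OF T] by (simp add: f_def odd_sum_insert)
    moreover have "f T \<subseteq> {1..N}" using j[OF T] sub assms(1) by (force simp: f_def)
    moreover have "f T \<inter> {2..r - 1} = T"
      using T j[OF T] assms(1) by (auto simp: f_def U_def)
    ultimately show ?thesis by (simp add: odd_distinct_def)
  qed
  \<comment> \<open>The index 1 and \<open>j T\<close> lie outside \<open>{2..r - 1}\<close>, so
    \<open>T\<close> can be read off from \<open>f T\<close>.\<close>
  have "inj_on f (Pow {2..r - 1})" using f by (intro inj_onI) (metis PowD)
  moreover have "f ` Pow {2..r - 1} \<subseteq> odd_distinct N m" using f by auto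
  moreover have "finite (odd_distinct N m)"
    by (rule finite_subset[of _ "Pow {1..N}"]) (auto simp: odd_distinct_def)
  ultimately have "card (Pow {2..r - 1}) \<le> card (odd_distinct N m)"
    by (metis card_image card_mono)
  then show ?thesis using assms(1) by (simp add: card_Pow numeral_2_eq_2)
qed

section \<open>Weighted partitions and the crank\<close>

text \<open>Weights are multiplicative over the parts: the value \<open>-1\<close> at
  \<open>j\<close> turns the factor \<open>1 / (1 - q ^ j)\<close> of the generating function into
  \<open>1 / (1 + q ^ j)\<close>.\<close>

definition weighted_partitions :: "(nat \<Rightarrow> 'a::comm_ring_1) \<Rightarrow> nat set \<Rightarrow> nat \<Rightarrow> 'a" where
  "weighted_partitions c A n = (\<Sum>l | set_mset l \<subseteq> A \<and> \<Sum>\<^sub># l = n. \<Prod>\<^sub># (image_mset c l))"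

lemma finite_restricted_partitions:
  fixes n :: nat
  shows "0 \<notin> A \<Longrightarrow> finite {l. set_mset l \<subseteq> A \<and> \<Sum>\<^sub># l = n}"
  by (rule finite_subset[OF _ finite_partitions[of n]]) (auto simp: partitions_def)

lemma weighted_partitions_empty: "weighted_partitions c {} n = (if n = 0 then 1 else 0)"
proof -
  have "{l. set_mset l \<subseteq> {} \<and> \<Sum>\<^sub># l = n} = (if n = 0 then {{#}} else {})" by auto
  then show ?thesis by (simp add: weighted_partitions_def)
qed

lemma weighted_partitions_insert:
  assumes "0 \<notin> insert a A" "a \<notin> A"
  shows "weighted_partitions c (insert a A) n = weighted_partitions c A n
           + (if a \<le> n then c a * weighted_partitions c (insert a A) (n - a) else 0)"
proof -
  define S where "S = {l. set_mset l \<subseteq> insert a A \<and> \<Sum>\<^sub># l = n}"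
  have fin: "finite S"
    using finite_restricted_partitions[OF assms(1)] by (simp add: S_def)
  have "sum g S = sum g {l \<in> S. a \<notin># l} + sum g {l \<in> S. a \<in># l}" for g :: "nat multiset \<Rightarrow> 'a"
    by (subst sum.union_disjoint[symmetric]) (auto simp: fin intro!: sum.cong)
  moreover have "{l \<in> S. a \<notin># l} = {l. set_mset l \<subseteq> A \<and> \<Sum>\<^sub># l = n}"
    using assms(2) by (auto simp: S_def)
  moreover have "(\<Sum>l | l \<in> S \<and> a \<in># l. \<Prod>\<^sub># (image_mset c l))
      = (if a \<le> n then c a * weighted_partitions c (insert a A) (n - a) else 0)"
  proof (cases "a \<le> n")
    case True
    have "(\<Sum>l | l \<in> S \<and> a \<in># l. \<Prod>\<^sub># (image_mset c l))
        = (\<Sum>l | set_mset l \<subseteq> insert a A \<and> \<Sum>\<^sub># l = n - a. c a * \<Prod>\<^sub># (image_mset c l))"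
      by (rule sum.reindex_bij_witness[where i = "add_mset a" and j = "\<lambda>l. l - {#a#}"])
        (use True in \<open>auto simp: S_def dest!: multi_member_split dest: in_diffD\<close>)
    then show ?thesis using True by (simp add: weighted_partitions_def sum_distrib_left)
  next
    case False
    then have "{l. l \<in> S \<and> a \<in># l} = {}"
      by (auto simp: S_def dest!: multi_member_split)
    then show ?thesis using False by (simp only: sum.empty if_False)
  qed
  ultimately show ?thesis by (simp add: weighted_partitions_def S_def)
qed

text \<open>By \<open>weighted_partitions_insert\<close>, multiplying by the factor of
  \<open>a\<close> removes \<open>a\<close> from the admissible parts.\<close>

lemma weighted_partitions_gf:
  assumes "finite A" "0 \<notin> A"
  shows "Abs_fps (weighted_partitions c A) * (\<Prod>j\<in>A. 1 - fps_const (c j) * fps_X ^ j) = 1"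
  using assms
proof (induction A rule: finite_induct)
  case empty
  show ?case by (rule fps_ext) (simp add: weighted_partitions_empty)
next
  case (insert a A)
  have "Abs_fps (weighted_partitions c (insert a A)) * (1 - fps_const (c a) * fps_X ^ a)
      = Abs_fps (weighted_partitions c A)"
  proof (rule fps_ext)
    fix n
    let ?G = "Abs_fps (weighted_partitions c (insert a A))"
    have "?G * (1 - fps_const (c a) * fps_X ^ a) = ?G - fps_const (c a) * (fps_X ^ a * ?G)"
      by (simp add: algebra_simps)
    then show "fps_nth (?G * (1 - fps_const (c a) * fps_X ^ a)) n = fps_nth (Abs_fps (weighted_partitions c A)) n"
      using weighted_partitions_insert[of a A c n] insert by (simp add: fps_X_power_mult_nth)
  qed
  then show ?case using insert by (simp flip: mult.assoc)
qed

section \<open>Crank signs as weighted partition counts\<close>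

definition crank_sign :: "nat multiset \<Rightarrow> real" where
  "crank_sign l = (if even (crank l) then 1 else -1)"

lemma M0_minus_M1: "real (M0 n) - real (M1 n) = sum crank_sign (partitions n)"
proof -
  have "sum crank_sign (partitions n)
      = sum crank_sign {l \<in> partitions n. even (crank l)} + sum crank_sign {l \<in> partitions n. odd (crank l)}"
    by (subst sum.union_disjoint[symmetric]) (auto simp: finite_partitions intro!: sum.cong)
  then show ?thesis by (simp add: crank_sign_def M0_def M1_def)
qed

lemma partitions_le:
  assumes "l \<in> partitions n" "x \<in># l"
  shows "0 < x" "x \<le> n"
  using assms by (auto simp: partitions_def dest!: multi_member_split)

definition above_sign :: "nat \<Rightarrow> nat \<Rightarrow> real" where
  "above_sign w j = (if w < j then -1 else 1)"

lemma prod_above_sign: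
  "\<Prod>\<^sub># (image_mset (above_sign w) l) = (-1) ^ size (filter_mset (\<lambda>k. w < k) l)"
  by (induction l) (simp_all add: above_sign_def)

text \<open>As \<open>w >= 1\<close>, deleting the ones does not change the number of parts above
  \<open>w\<close>, and the crank has the parity of that number plus \<open>w\<close>.\<close>

lemma sum_crank_sign_ones:
  assumes "1 \<le> w" "w \<le> n"
  shows "(\<Sum>l | l \<in> partitions n \<and> ones l = w. crank_sign l)
           = (-1) ^ w * weighted_partitions (above_sign w) {2..n} (n - w)"
proof -
  have split: "filter_mset (\<lambda>x. x \<noteq> 1) l + replicate_mset (ones l) 1 = l" for l :: "nat multiset"
    by (rule multiset_eqI) (simp add: ones_def)
  have sum_split: "\<Sum>\<^sub># l = \<Sum>\<^sub># (filter_mset (\<lambda>x. x \<noteq> 1) l) + ones l" for l :: "nat multiset"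
    by (subst split[of l, symmetric]) (simp add: sum_mset_replicate_mset)
  have "(\<Sum>l | l \<in> partitions n \<and> ones l = w. crank_sign l)
      = (\<Sum>l | set_mset l \<subseteq> {2..n} \<and> \<Sum>\<^sub># l = n - w. (-1) ^ w * \<Prod>\<^sub># (image_mset (above_sign w) l))"
  proof (rule sum.reindex_bij_witness[where i = "\<lambda>l. l + replicate_mset w 1"
        and j = "filter_mset (\<lambda>x. x \<noteq> 1)"])
    fix l assume l: "l \<in> {l. l \<in> partitions n \<and> ones l = w}"
    then have w: "ones l = w" and n: "\<Sum>\<^sub># l = n" by (auto simp: partitions_def)
    show "filter_mset (\<lambda>x. x \<noteq> 1) l + replicate_mset w 1 = l" using split[of l] w by simp
    have "x \<in> {2..n}" if "x \<in># l" "x \<noteq> 1" for x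
      using partitions_le[of l n x] l that by auto
    then show "filter_mset (\<lambda>x. x \<noteq> 1) l \<in> {l. set_mset l \<subseteq> {2..n} \<and> \<Sum>\<^sub># l = n - w}"
      using sum_split[of l] w n by auto
    have "filter_mset (\<lambda>k. w < k) (filter_mset (\<lambda>x. x \<noteq> 1) l) = filter_mset (\<lambda>k. w < k) l"
      using assms(1) by (subst filter_filter_mset) (auto intro!: filter_mset_cong)
    then show "(-1) ^ w * \<Prod>\<^sub># (image_mset (above_sign w) (filter_mset (\<lambda>x. x \<noteq> 1) l)) = crank_sign l"
      unfolding prod_above_sign using assms(1) w
      by (auto simp: crank_sign_def crank_def parts_above_ones_def minus_one_power_iff)
  next
    fix l assume l: "l \<in> {l. set_mset l \<subseteq> {2..n} \<and> \<Sum>\<^sub># l = n - w}"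
    then have "1 \<notin># l" "0 \<notin># l" by auto
    then show "filter_mset (\<lambda>x. x \<noteq> 1) (l + replicate_mset w 1) = l"
      by (intro multiset_eqI) (auto simp: not_in_iff)
    show "l + replicate_mset w 1 \<in> {l. l \<in> partitions n \<and> ones l = w}"
      using l \<open>1 \<notin># l\<close> \<open>0 \<notin># l\<close> assms
      by (auto simp: partitions_def ones_def sum_mset_replicate_mset not_in_iff)
  qed
  then show ?thesis by (simp add: weighted_partitions_def sum_distrib_left)
qed

text \<open>Without ones the sign depends only on the largest part \<open>m\<close>; deleting one
  copy of it leaves arbitrary parts in \<open>{2..m}\<close>.\<close>

lemma sum_crank_sign_no_ones:
  assumes "0 < n"
  shows "(\<Sum>l | l \<in> partitions n \<and> ones l = 0. crank_sign l)
           = (\<Sum>m=2..n. (-1) ^ m * weighted_partitions (\<lambda>_. 1) {2..m} (n - m))"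
proof -
  define P where "P = {l. l \<in> partitions n \<and> ones l = 0}"
  have fin: "finite P" by (simp add: P_def finite_partitions)
  have mem: "2 \<le> x \<and> x \<le> n" if "l \<in> P" "x \<in># l" for l x
    using partitions_le[of l n x] that by (cases "x = 1") (auto simp: P_def ones_def count_eq_zero_iff)
  have ne: "l \<noteq> {#}" if "l \<in> P" for l
    using assms that by (auto simp: P_def partitions_def)
  have "(\<lambda>l. Max (set_mset l)) ` P \<subseteq> {2..n}"
  proof
    fix m assume "m \<in> (\<lambda>l. Max (set_mset l)) ` P"
    then obtain l where "l \<in> P" "m = Max (set_mset l)" by auto
    then show "m \<in> {2..n}" using mem[of l m] Max_in[of "set_mset l"] ne[of l] by auto
  qed
  then have "sum crank_sign P = (\<Sum>m=2..n. \<Sum>l | l \<in> P \<and> Max (set_mset l) = m. crank_sign l)"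
    by (intro sum.group[symmetric] fin) auto
  also have "\<dots> = (\<Sum>m=2..n. (-1) ^ m * weighted_partitions (\<lambda>_. 1) {2..m} (n - m))"
  proof (rule sum.cong)
    fix m assume m: "m \<in> {2..n}"
    have "(\<Sum>l | l \<in> P \<and> Max (set_mset l) = m. crank_sign l)
        = (\<Sum>l | set_mset l \<subseteq> {2..m} \<and> \<Sum>\<^sub># l = n - m. (-1) ^ m)"
    proof (rule sum.reindex_bij_witness[where i = "add_mset m" and j = "\<lambda>l. l - {#m#}"])
      fix l assume l: "l \<in> {l. l \<in> P \<and> Max (set_mset l) = m}"
      then have "m \<in># l" using Max_in[of "set_mset l"] ne[of l] by auto
      then show "add_mset m (l - {#m#}) = l" by simp
      have "x \<in> {2..m}" if "x \<in># l" for x using mem[of l x] l that by auto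
      then show "l - {#m#} \<in> {l. set_mset l \<subseteq> {2..m} \<and> \<Sum>\<^sub># l = n - m}"
        using l \<open>m \<in># l\<close> by (auto simp: P_def partitions_def dest!: multi_member_split dest: in_diffD)
      have "Max (insert 0 (set_mset l)) = m"
        using l \<open>m \<in># l\<close> by (subst Max_insert) auto
      then show "(-1) ^ m = crank_sign l"
        using l by (simp add: crank_sign_def crank_def P_def)
    next
      fix l assume l: "l \<in> {l. set_mset l \<subseteq> {2..m} \<and> \<Sum>\<^sub># l = n - m}"
      then have "1 \<notin># l" "0 \<notin># l" by auto
      moreover have "Max (insert m (set_mset l)) = m"
        using l by (intro Max_eqI) auto
      ultimately show "add_mset m l \<in> {l. l \<in> P \<and> Max (set_mset l) = m}"
        using l m by (auto simp: P_def partitions_def ones_def not_in_iff)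
    qed simp
    then show "(\<Sum>l | l \<in> P \<and> Max (set_mset l) = m. crank_sign l)
        = (-1) ^ m * weighted_partitions (\<lambda>_. 1) {2..m} (n - m)"
      by (simp add: weighted_partitions_def)
  qed simp
  finally show ?thesis by (simp add: P_def)
qed

lemma M0_minus_M1_weighted:
  assumes "0 < n"
  shows "real (M0 n) - real (M1 n) = (\<Sum>m=2..n. (-1) ^ m * weighted_partitions (\<lambda>_. 1) {2..m} (n - m))
     + (\<Sum>w=1..n. (-1) ^ w * weighted_partitions (above_sign w) {2..n} (n - w))"
proof -
  have "ones l \<le> n" if "l \<in> partitions n" for l
  proof -
    have "replicate_mset (ones l) 1 \<subseteq># l" by (simp add: ones_def count_le_replicate_mset_subset_eq[symmetric])
    then have "\<Sum>\<^sub># (replicate_mset (ones l) 1) \<le> \<Sum>\<^sub># l"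
      by (metis le_add1 subset_mset.add_diff_inverse sum_mset.union)
    then show ?thesis using that by (simp add: partitions_def sum_mset_replicate_mset)
  qed
  then have "sum crank_sign (partitions n) = (\<Sum>w=0..n. \<Sum>l | l \<in> partitions n \<and> ones l = w. crank_sign l)"
    by (intro sum.group[symmetric] finite_partitions) auto
  also have "\<dots> = (\<Sum>l | l \<in> partitions n \<and> ones l = 0. crank_sign l)
      + (\<Sum>w=1..n. \<Sum>l | l \<in> partitions n \<and> ones l = w. crank_sign l)"
    by (simp add: sum.atLeast_Suc_atMost)
  finally show ?thesis
    using sum_crank_sign_no_ones[OF assms] sum_crank_sign_ones by (simp add: M0_minus_M1)
qed

section \<open>The parity of the crank\<close>

lemma qbinom_coeff_mult_prod:
  "qbinom_coeff a m * (\<Prod>j=1..m. 1 - fps_X ^ j) = (\<Prod>i<m. 1 - a * fps_X ^ i)"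
proof (induction m)
  case (Suc m)
  have "qbinom_coeff a (Suc m) * (\<Prod>j=1..Suc m. 1 - fps_X ^ j)
      = (qbinom_coeff a (Suc m) * (1 - fps_X ^ Suc m)) * (\<Prod>j=1..m. 1 - fps_X ^ j)"
    by (simp add: mult_ac del: power_Suc)
  also have "\<dots> = (1 - a * fps_X ^ m) * (qbinom_coeff a m * (\<Prod>j=1..m. 1 - fps_X ^ j))"
    by (simp only: qbinom_coeff_Suc mult_ac)
  finally show ?case
    unfolding Suc.IH by (simp add: mult.commute)
qed simp

lemma prod_split_first:
  fixes f :: "nat \<Rightarrow> 'a::comm_monoid_mult"
  shows "1 \<le> m \<Longrightarrow> f 1 * (\<Prod>j=2..m. f j) = (\<Prod>j=1..m. f j)"
  by (simp only: prod.atLeast_Suc_atMost[of 1 m] Suc_1)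

text \<open>The missing factor \<open>1 - q\<close> completes the denominator to
  \<open>(q; q)_m\<close>, which is the case \<open>a = 0\<close> of
  \<open>qbinom_coeff\<close>.\<close>

lemma gf_no_ones:
  assumes "1 \<le> m"
  shows "Abs_fps (weighted_partitions (\<lambda>_. 1 :: real) {2..m}) = (1 - fps_X) * qbinom_coeff 0 m"
proof -
  have inv: "Abs_fps (weighted_partitions (\<lambda>_. 1 :: real) {2..m}) * (\<Prod>j=2..m. 1 - fps_X ^ j) = 1"
    using weighted_partitions_gf[of "{2..m}" "\<lambda>_. 1 :: real"] by simp
  have "(1 - fps_X) * qbinom_coeff 0 m * (\<Prod>j=2..m. 1 - fps_X ^ j)
      = qbinom_coeff 0 m * ((1 - fps_X ^ 1) * (\<Prod>j=2..m. 1 - fps_X ^ j :: real fps))"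
    by (simp add: mult_ac)
  also have "\<dots> = 1"
    by (subst prod_split_first[OF assms, of "\<lambda>j. 1 - fps_X ^ j"]) (simp only: qbinom_coeff_mult_prod, simp)
  finally have "(1 - fps_X) * qbinom_coeff 0 m * (\<Prod>j=2..m. 1 - fps_X ^ j) = (1 :: real fps)" .
  then show ?thesis using inv by (metis mult_right_cancel mult_zero_right zero_neq_one)
qed

text \<open>The denominator consists of \<open>1 - q ^ j\<close> for \<open>2 <= j <= w\<close> and
  \<open>1 + q ^ j\<close> for \<open>w < j <= n\<close>. The full product thus leaves
  \<open>(-q; q)_w\<close> in the numerator: the case \<open>a = -q\<close>.\<close>

lemma gf_ones:
  assumes "1 \<le> w" "w \<le> n"
  shows "Abs_fps (weighted_partitions (above_sign w) {2..n}) * (\<Prod>k=1..n. 1 + fps_X ^ k)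
           = (1 - fps_X) * qbinom_coeff (- fps_X) w"
proof -
  define v :: "real fps" where "v = (\<Prod>j=2..n. 1 - fps_const (above_sign w j) * fps_X ^ j)"
  define E :: "real fps" where "E = (\<Prod>k=1..n. 1 + fps_X ^ k)"
  have G: "Abs_fps (weighted_partitions (above_sign w) {2..n}) * v = 1"
    unfolding v_def by (rule weighted_partitions_gf) auto
  have "{2..n} = {2..w} \<union> {w<..n}" using assms by auto
  then have "v = (\<Prod>j\<in>{2..w} \<union> {w<..n}. 1 - fps_const (above_sign w j) * fps_X ^ j)"
    by (simp only: v_def)
  also have "\<dots> = (\<Prod>j=2..w. 1 - fps_const (above_sign w j) * fps_X ^ j)
      * (\<Prod>j\<in>{w<..n}. 1 - fps_const (above_sign w j) * fps_X ^ j)"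
    by (rule prod.union_disjoint) auto
  also have "(\<Prod>j=2..w. 1 - fps_const (above_sign w j) * fps_X ^ j) = (\<Prod>j=2..w. 1 - fps_X ^ j)"
    by (rule prod.cong) (auto simp: above_sign_def)
  also have "(\<Prod>j\<in>{w<..n}. 1 - fps_const (above_sign w j) * fps_X ^ j) = (\<Prod>j\<in>{w<..n}. 1 + fps_X ^ j)"
    by (rule prod.cong) (auto simp: above_sign_def simp flip: fps_const_neg)
  finally have v: "v = (\<Prod>j=2..w. 1 - fps_X ^ j) * (\<Prod>j\<in>{w<..n}. 1 + fps_X ^ j)" .
  have "(1 - fps_X) * qbinom_coeff (- fps_X) w * v = qbinom_coeff (- fps_X) w
      * ((1 - fps_X ^ 1) * (\<Prod>j=2..w. 1 - fps_X ^ j)) * (\<Prod>j\<in>{w<..n}. 1 + fps_X ^ j)"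
    by (simp add: v mult_ac)
  also have "\<dots> = qbinom_coeff (- fps_X) w * (\<Prod>j=1..w. 1 - fps_X ^ j) * (\<Prod>j\<in>{w<..n}. 1 + fps_X ^ j)"
    by (subst prod_split_first[OF assms(1), of "\<lambda>j. 1 - fps_X ^ j"]) simp
  also have "qbinom_coeff (- fps_X) w * (\<Prod>j=1..w. 1 - fps_X ^ j) = (\<Prod>i<w. 1 + fps_X ^ Suc i :: real fps)"
    by (simp only: qbinom_coeff_mult_prod) simp
  also have "(\<Prod>i<w. 1 + fps_X ^ Suc i) = (\<Prod>j=1..w. 1 + fps_X ^ j :: real fps)"
    by (simp only: prod.atLeast1_atMost_eq One_nat_def)
  also have "\<dots> * (\<Prod>j\<in>{w<..n}. 1 + fps_X ^ j) = (\<Prod>j\<in>{1..w} \<union> {w<..n}. 1 + fps_X ^ j)"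
    by (rule prod.union_disjoint[symmetric]) auto
  also have "{1..w} \<union> {w<..n} = {1..n}" using assms by auto
  finally have "(1 - fps_X) * qbinom_coeff (- fps_X) w * v = E" by (simp only: E_def)
  moreover have "Abs_fps (weighted_partitions (above_sign w) {2..n}) * E * v = E"
    using G by (metis mult.assoc mult.commute mult_1_right)
  moreover have "v \<noteq> 0" using G by auto
  ultimately have "Abs_fps (weighted_partitions (above_sign w) {2..n}) * E
      = (1 - fps_X) * qbinom_coeff (- fps_X) w"
    by (metis mult_right_cancel)
  then show ?thesis by (simp only: E_def)
qed

definition crank_gf :: "nat \<Rightarrow> real fps" where
  "crank_gf n = (\<Sum>m=2..n. (- fps_X) ^ m * Abs_fps (weighted_partitions (\<lambda>_. 1) {2..m}))
     + (\<Sum>w=1..n. (- fps_X) ^ w * Abs_fps (weighted_partitions (above_sign w) {2..n}))"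

lemma fps_nth_crank_gf:
  assumes "0 < n"
  shows "fps_nth (crank_gf n) n = real (M0 n) - real (M1 n)"
proof -
  have "fps_nth ((- fps_X) ^ m * f) n = (-1) ^ m * fps_nth f (n - m)" if "m \<le> n" for m and f :: "real fps"
    using that by (simp add: uminus_power_if fps_X_power_mult_nth)
  then show ?thesis
    unfolding M0_minus_M1_weighted[OF assms]
    by (simp add: crank_gf_def fps_sum_nth)
qed

text \<open>The summand \<open>1 - 2 * fps_X\<close> supplies the terms \<open>m = 0, 1\<close> missing from the first sum of
  \<open>crank_gf\<close>; it does not affect the coefficients from degree 2 on.\<close>

lemma crank_gf_mult:
  assumes "2 \<le> n"
  defines "E \<equiv> (\<Prod>k=1..n. 1 + fps_X ^ k)"
  shows "(crank_gf n + (1 - 2 * fps_X)) * E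
     = (1 - fps_X) * (E * qbinom_sum 0 n (- fps_X) + qbinom_sum (- fps_X) n (- fps_X) - 1)"
proof -
  have sum_gf: "(\<Sum>m=2..n. (- fps_X) ^ m * Abs_fps (weighted_partitions (\<lambda>_. 1 :: real) {2..m}))
      = (1 - fps_X) * (\<Sum>m=2..n. qbinom_coeff 0 m * (- fps_X) ^ m)"
    using gf_no_ones by (simp add: sum_distrib_left mult_ac)
  have sum_eq: "qbinom_sum 0 n (- fps_X) = 1 + qbinom_coeff 0 1 * (- fps_X)
      + (\<Sum>m=2..n. qbinom_coeff 0 m * (- fps_X) ^ m :: real fps)"
    unfolding qbinom_sum_def atMost_atLeast0 using assms(1)
    by (simp add: sum.atLeast_Suc_atMost numeral_2_eq_2)
  \<comment> \<open>The terms \<open>m = 0, 1\<close>, multiplied by \<open>1 - q\<close>, are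
    therefore \<open>1 - q\<close> and \<open>-q\<close>, with sum \<open>1 - 2 * q\<close>.\<close>
  have coeff_1: "(1 - fps_X) * qbinom_coeff 0 1 = (1 :: real fps)"
    using qbinom_coeff_Suc[of "0 :: real fps" 0] by (simp add: mult_ac)
  have "(1 - fps_X) * qbinom_sum 0 n (- fps_X) = (1 - fps_X) + ((1 - fps_X) * qbinom_coeff 0 1) * (- fps_X)
      + (1 - fps_X) * (\<Sum>m=2..n. qbinom_coeff 0 m * (- fps_X) ^ m :: real fps)"
    unfolding sum_eq by (simp only: distrib_left mult_1_right mult.assoc)
  then have no_ones: "(\<Sum>m=2..n. (- fps_X) ^ m * Abs_fps (weighted_partitions (\<lambda>_. 1 :: real) {2..m}))
      + (1 - 2 * fps_X) = (1 - fps_X) * qbinom_sum 0 n (- fps_X)"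
    unfolding coeff_1 sum_gf by simp
  have "(\<Sum>w=1..n. (- fps_X) ^ w * Abs_fps (weighted_partitions (above_sign w) {2..n})) * E
      = (\<Sum>w=1..n. (- fps_X) ^ w * ((1 - fps_X) * qbinom_coeff (- fps_X) w))"
    unfolding sum_distrib_right
    using gf_ones[of _ n] by (intro sum.cong) (simp_all add: E_def mult.assoc)
  also have "\<dots> = (1 - fps_X) * (\<Sum>w=1..n. qbinom_coeff (- fps_X) w * (- fps_X) ^ w)"
    by (simp add: sum_distrib_left mult_ac)
  also have "(\<Sum>w=1..n. qbinom_coeff (- fps_X) w * (- fps_X) ^ w) = qbinom_sum (- fps_X) n (- fps_X :: real fps) - 1"
    unfolding qbinom_sum_def atMost_atLeast0 by (simp add: sum.atLeast_Suc_atMost)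
  finally have ones: "(\<Sum>w=1..n. (- fps_X) ^ w * Abs_fps (weighted_partitions (above_sign w) {2..n})) * E
      = (1 - fps_X) * (qbinom_sum (- fps_X) n (- fps_X) - 1)" .
  have "(crank_gf n + (1 - 2 * fps_X)) * E
      = ((\<Sum>m=2..n. (- fps_X) ^ m * Abs_fps (weighted_partitions (\<lambda>_. 1 :: real) {2..m})) + (1 - 2 * fps_X)) * E
        + (\<Sum>w=1..n. (- fps_X) ^ w * Abs_fps (weighted_partitions (above_sign w) {2..n})) * E"
    unfolding crank_gf_def by (simp add: distrib_right)
  then show ?thesis
    unfolding no_ones ones by (simp add: algebra_simps)
qed

text \<open>The case \<open>a = 0\<close> of the q-binomial theorem cancels the \<open>- 1\<close>
  in \<open>crank_gf_mult\<close>, leaving \<open>S * E = (1 - q) * Q\<close>; the case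
  \<open>a = -q\<close> evaluates \<open>E * Q\<close>. Hence \<open>S * E * E = R = T * E\<close>
  up to degree \<open>n\<close>, and two multiplications by \<open>Od\<close>, the inverse of
  \<open>E\<close>, give \<open>S = T * Od\<close>.\<close>

lemma crank_gf_upto:
  assumes "2 \<le> n"
  shows "fps_eq_upto n (crank_gf n + (1 - 2 * fps_X))
     ((1 + 2 * (\<Sum>s=1..n. (-1) ^ s * fps_X ^ (s\<^sup>2))) * (\<Prod>k=1..n. 1 - fps_X ^ (2 * k - 1)))"
proof -
  define E :: "real fps" where "E = (\<Prod>k=1..n. 1 + fps_X ^ k)"
  define Od :: "real fps" where "Od = (\<Prod>k=1..n. 1 - fps_X ^ (2 * k - 1))"
  define R :: "real fps" where "R = (\<Prod>k=1..n. 1 - fps_X ^ k)"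
  define T :: "real fps" where "T = theta_ratio 0 n"
  define Q :: "real fps" where "Q = qbinom_sum (- fps_X) n (- fps_X)"
  define S where "S = crank_gf n + (1 - 2 * fps_X)"
  have EO: "fps_eq_upto n (E * Od) 1"
    unfolding E_def Od_def by (rule euler_odd_distinct_upto)
  have "fps_eq_upto n ((1 - fps_X) * (E * qbinom_sum 0 n (- fps_X) + (Q - 1))) ((1 - fps_X) * (1 + (Q - 1)))"
    using qbinom_theorem_upto[of n 0]
    by (intro fps_eq_upto_mult fps_eq_upto_add fps_eq_upto_refl) (simp add: E_def)
  moreover have "S * E = (1 - fps_X) * (E * qbinom_sum 0 n (- fps_X) + (Q - 1))"
    using crank_gf_mult[OF assms] by (simp only: S_def E_def Q_def add_diff_eq)
  ultimately have SE: "fps_eq_upto n (S * E) ((1 - fps_X) * Q)"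
    by simp
  have EQ: "fps_eq_upto n (E * Q) (\<Prod>k=1..n. 1 - fps_X ^ Suc k)"
    using qbinom_theorem_upto[of n "- fps_X :: real fps"] by (simp add: E_def Q_def)
  have "fps_eq_upto n (S * E * E) ((1 - fps_X) * Q * E)"
    by (intro fps_eq_upto_mult SE fps_eq_upto_refl)
  also have "(1 - fps_X) * Q * E = (1 - fps_X) * (E * Q)" by (simp add: mult_ac)
  also have "fps_eq_upto n \<dots> ((1 - fps_X) * (\<Prod>k=1..n. 1 - fps_X ^ Suc k))"
    by (intro fps_eq_upto_mult EQ fps_eq_upto_refl)
  \<comment> \<open>The shifted product takes in \<open>1 - q\<close> as its factor
    \<open>k = 1\<close>; the extra factor \<open>k = n + 1\<close> is 1 up to degree
    \<open>n\<close>.\<close>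
  also have "(1 - fps_X) * (\<Prod>k=1..n. 1 - fps_X ^ Suc k) = R * (1 - fps_X ^ Suc n)"
  proof -
    have "(\<Prod>k=1..n. 1 - fps_X ^ Suc k) = (\<Prod>k=2..Suc n. 1 - fps_X ^ k :: real fps)"
      by (subst numeral_2_eq_2) (simp only: One_nat_def prod.shift_bounds_cl_Suc_ivl)
    then have "(1 - fps_X) * (\<Prod>k=1..n. 1 - fps_X ^ Suc k)
        = (1 - fps_X ^ 1) * (\<Prod>k=2..Suc n. 1 - fps_X ^ k :: real fps)"
      by (simp only: power_one_right)
    also have "\<dots> = (\<Prod>k=1..Suc n. 1 - fps_X ^ k)"
      by (rule prod_split_first[of "Suc n" "\<lambda>k. 1 - fps_X ^ k"]) simp
    also have "\<dots> = R * (1 - fps_X ^ Suc n)" by (simp add: R_def)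
    finally show ?thesis .
  qed
  also have "fps_eq_upto n (R * (1 - fps_X ^ Suc n)) (R * 1)"
    by (intro fps_eq_upto_mult fps_eq_upto_refl) (simp add: fps_eq_upto_def del: power_Suc)
  also have "R * 1 = T * E"
  proof -
    have "(1 - fps_X ^ k) * inverse (1 + fps_X ^ k) * (1 + fps_X ^ k) = (1 - fps_X ^ k :: real fps)"
      if "k \<in> {1..n}" for k
      using fps_one_plus_X_power_inverse[of k, where ?'a = real] that
      by (subst mult.assoc) (metis atLeastAtMost_iff less_le_trans less_one mult.right_neutral)
    then have "(\<Prod>k=1..n. (1 - fps_X ^ k) * inverse (1 + fps_X ^ k) * (1 + fps_X ^ k)) = R"
      unfolding R_def by (intro prod.cong) auto
    moreover have "{0<..n} = {1..n}" by auto
    ultimately show ?thesis by (simp only: T_def E_def theta_ratio_def prod.distrib mult_1_right)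
  qed
  finally have SEE: "fps_eq_upto n (S * E * E) (T * E)" .
  have "fps_eq_upto n (S * 1 * 1) (S * (E * Od) * (E * Od))"
    by (intro fps_eq_upto_mult fps_eq_upto_refl fps_eq_upto_sym[OF EO])
  also have "\<dots> = (S * E * E) * (Od * Od)" by (simp add: mult_ac)
  also have "fps_eq_upto n \<dots> ((T * E) * (Od * Od))"
    by (intro fps_eq_upto_mult SEE fps_eq_upto_refl)
  also have "(T * E) * (Od * Od) = (T * Od) * (E * Od)" by (simp add: mult_ac)
  also have "fps_eq_upto n \<dots> (((1 + 2 * (\<Sum>s=1..n. (-1) ^ s * fps_X ^ (s\<^sup>2))) * Od) * 1)"
    unfolding T_def by (intro fps_eq_upto_mult EO theta_product_upto fps_eq_upto_refl)
  finally show ?thesis by (simp add: S_def Od_def)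
qed

section \<open>Coefficient extraction and the lower bound\<close>

lemma M0_minus_M1_theta:
  assumes "2 \<le> n"
  shows "(-1) ^ n * (real (M0 n) - real (M1 n)) = real (card (odd_distinct n n))
     + 2 * (\<Sum>s=1..n. if s\<^sup>2 \<le> n then real (card (odd_distinct n (n - s\<^sup>2))) else 0)"
proof -
  define Od :: "real fps" where "Od = (\<Prod>k=1..n. 1 - fps_X ^ (2 * k - 1))"
  have Od: "fps_nth Od m = (-1) ^ m * real (card (odd_distinct n m))" for m
    unfolding Od_def by (rule fps_nth_odd_product)
  have "real (M0 n) - real (M1 n) = fps_nth (crank_gf n + (1 - 2 * fps_X)) n"
    using assms fps_nth_crank_gf[of n] by (simp add: numeral_fps_const)
  also have "\<dots> = fps_nth ((1 + 2 * (\<Sum>s=1..n. (-1) ^ s * fps_X ^ (s\<^sup>2))) * Od) n"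
    unfolding Od_def by (rule fps_eq_upto_nth[OF crank_gf_upto[OF assms]]) simp
  also have "(1 + 2 * (\<Sum>s=1..n. (-1) ^ s * fps_X ^ (s\<^sup>2))) * Od
      = Od + fps_const 2 * (\<Sum>s=1..n. fps_const ((-1) ^ s) * (fps_X ^ (s\<^sup>2) * Od))"
  proof -
    have "(-1) ^ s = fps_const ((-1) ^ s :: real)" for s :: nat
      by (cases "even s") (simp_all flip: fps_const_neg)
    then show ?thesis
      by (simp only: distrib_right sum_distrib_right mult.assoc mult_1_left numeral_fps_const)
  qed
  also have "fps_nth \<dots> n = fps_nth Od n
      + 2 * (\<Sum>s=1..n. (-1) ^ s * (if s\<^sup>2 \<le> n then fps_nth Od (n - s\<^sup>2) else 0))"
    by (auto simp: fps_sum_nth fps_X_power_mult_nth intro!: sum.cong)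
  finally have "(-1) ^ n * (real (M0 n) - real (M1 n)) = (-1) ^ n * fps_nth Od n
      + 2 * (\<Sum>s=1..n. (-1) ^ n * ((-1) ^ s * (if s\<^sup>2 \<le> n then fps_nth Od (n - s\<^sup>2) else 0)))"
    by (simp add: distrib_left sum_distrib_left mult_ac)
  \<comment> \<open>The signs cancel because \<open>s\<close> and \<open>s^2\<close> have the same
    parity.\<close>
  moreover have "(-1) ^ n * ((-1) ^ s * (if s\<^sup>2 \<le> n then fps_nth Od (n - s\<^sup>2) else 0))
      = (if s\<^sup>2 \<le> n then real (card (odd_distinct n (n - s\<^sup>2))) else 0)" for s
    by (auto simp: Od minus_one_power_iff)
  ultimately show ?thesis by (simp add: Od)
qed

text \<open>All terms are nonnegative. Kept are \<open>s = 0\<close> and, counted twice,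
  \<open>s = 1\<close>; for the latter the slack in \<open>r^2 <= m + 1\<close> admits
  \<open>m = n - 1\<close>.\<close>

lemma M0_minus_M1_ge:
  assumes "2 \<le> r" "r\<^sup>2 \<le> n"
  shows "3 * 2 ^ (r - 2) \<le> (-1) ^ n * (int (M0 n) - int (M1 n))"
proof -
  have "2\<^sup>2 \<le> r\<^sup>2" using assms(1) by (intro power_mono) auto
  then have n: "4 \<le> n" using assms(2) by simp
  have le: "2 ^ (r - 2) \<le> real (card (odd_distinct n m))" if "r\<^sup>2 \<le> m + 1" "m \<le> n" for m
    using card_odd_distinct_ge[OF assms(1) that]
    by (metis of_nat_le_iff of_nat_numeral of_nat_power)
  let ?f = "\<lambda>s. if s\<^sup>2 \<le> n then real (card (odd_distinct n (n - s\<^sup>2))) else 0"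
  have "2 ^ (r - 2) \<le> ?f 1"
    using le[of "n - 1"] assms(2) n by simp
  also have "?f 1 \<le> (\<Sum>s=1..n. ?f s)"
    using n by (intro member_le_sum) auto
  finally have "2 ^ (r - 2) \<le> (\<Sum>s=1..n. ?f s)" .
  moreover have "2 ^ (r - 2) \<le> real (card (odd_distinct n n))"
    using le[of n] assms(2) by simp
  moreover have "2 \<le> n" using n by simp
  ultimately have "3 * 2 ^ (r - 2) \<le> (-1) ^ n * (real (M0 n) - real (M1 n))"
    unfolding M0_minus_M1_theta[OF \<open>2 \<le> n\<close>] by linarith
  then have "real_of_int (3 * 2 ^ (r - 2)) \<le> real_of_int ((-1) ^ n * (int (M0 n) - int (M1 n)))"
    by simp
  then show ?thesis by (simp only: of_int_le_iff)
qed

section \<open>Numerical comparison with \<open>d\<close>\<close>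

theorem theorem2p2:
  fixes d n :: nat
  assumes "d \<ge> 1"
    and "int n \<ge> \<lceil>24 / pi\<^sup>2 * (ln (7 * real d / 2))\<^sup>2 + 1 / 24\<rceil>"
  shows "(-1) ^ n * (int (M0 n) - int (M1 n)) > int d"
proof -
  define L where "L = ln (7 * real d / 2)"
  have "24 / pi\<^sup>2 * L\<^sup>2 + 1 / 24 \<le> real n"
    using assms(2) unfolding L_def by linarith
  moreover have pi2: "pi\<^sup>2 < 10"
  proof -
    have "pi < 3.16" using pi_approx by simp
    then have "pi\<^sup>2 < 3.16\<^sup>2" by (intro power_strict_mono) auto
    then show ?thesis by (simp add: power2_eq_square)
  qed
  moreover have "24 / 10 * L\<^sup>2 \<le> 24 / pi\<^sup>2 * L\<^sup>2"
    using pi2 by (intro mult_right_mono divide_left_mono) auto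
  ultimately have Ln: "24 / 10 * L\<^sup>2 + 1 / 24 \<le> real n" by linarith
  \<comment> \<open>This comes from \<open>2 ^ 9 = 512 < (7 / 2) ^ 5\<close>. Since
    \<open>24 / 10 * (6 / 5)^2 > 3\<close>, it forces \<open>n >= 4\<close>.\<close>
  have "6 / 5 \<le> ln (7 / 2 :: real)"
  proof -
    have "6 \<le> 9 * ln (2 :: real)" using ln2_ge_two_thirds by simp
    also have "\<dots> = ln (2 ^ 9)" by (subst ln_realpow) simp_all
    also have "\<dots> \<le> ln ((7 / 2) ^ 5)" by (subst ln_le_cancel_iff) (simp_all add: power_divide)
    also have "\<dots> = 5 * ln (7 / 2)" by (subst ln_realpow) simp_all
    finally show ?thesis by simp
  qed
  also have "\<dots> \<le> L" unfolding L_def using assms(1) by simp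
  finally have "6 / 5 \<le> L" .
  then have "(6 / 5)\<^sup>2 \<le> L\<^sup>2" by (intro power_mono) auto
  with Ln have "4 \<le> n" by (simp add: power2_eq_square)
  define r where "r = floor_sqrt n"
  have r: "r\<^sup>2 \<le> n" "n < (Suc r)\<^sup>2" unfolding r_def by (simp_all add: Suc_floor_sqrt_power2_gt)
  have "2 \<le> r" unfolding r_def using \<open>4 \<le> n\<close> by (simp add: le_floor_sqrt_iff)
  \<comment> \<open>The constant \<open>2 / 3\<close> is a lower bound for \<open>ln 2\<close>, and
    its square \<open>4 / 9\<close> still exceeds \<open>10 / 24\<close>.\<close>
  have "L\<^sup>2 < (2 / 3 * real (Suc r))\<^sup>2"
  proof -
    have "real n < (real (Suc r))\<^sup>2" using r(2) by (metis of_nat_less_iff of_nat_power)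
    moreover have "(2 / 3 * real (Suc r))\<^sup>2 = 4 / 9 * (real (Suc r))\<^sup>2"
      by (simp only: power_mult_distrib) (simp add: power_divide)
    ultimately show ?thesis
      using Ln zero_le_power2[of "real (Suc r)"] zero_le_power2[of L] by linarith
  qed
  then have "L < 2 / 3 * real (Suc r)" by (rule power2_less_imp_less) simp
  also have "\<dots> \<le> ln 2 * real (Suc r)"
    by (intro mult_right_mono ln2_ge_two_thirds) simp
  also have "\<dots> = ln (2 ^ Suc r)" by (simp add: ln_realpow mult.commute del: power_Suc)
  finally have "7 * real d / 2 < 2 ^ Suc r"
    unfolding L_def using assms(1) by (subst (asm) ln_less_cancel_iff) (auto simp del: power_Suc)
  moreover obtain q where "r = 2 + q" using \<open>2 \<le> r\<close> by (metis le_Suc_ex)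
  \<comment> \<open>Here \<open>2 * 2 ^ (r + 1) = 16 * 2 ^ (r - 2)\<close>, and
    \<open>16 / 7 < 3\<close>.\<close>
  ultimately have "7 * real d < 16 * 2 ^ (r - 2)" by simp
  then have "real_of_int (int d) < real_of_int (3 * 2 ^ (r - 2))"
    by simp
  then have "int d < 3 * 2 ^ (r - 2)" by (simp only: of_int_less_iff)
  also note M0_minus_M1_ge[OF \<open>2 \<le> r\<close> r(1)]
  finally show ?thesis .
qed

end
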